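(* Let $\mathcal A$ and $\mathfrak A$ be Banach algebras such that $\mathcal A$ is a Banach $\mathfrak A$-bimodule with compatible actions. Let $I$ and $J$ be nonempty linear subspaces of $\mathcal A$ and $\mathfrak A$, respectively. Then the following assertions hold. (i) The subspace $I\times J$ is a left ideal of $\mathcal A\rtimes\mathfrak A$ if and only if $I$ and $J$ are left ideals of $\mathcal A$ and $\mathfrak A$, respectively, and $I$ is a left $\mathfrak A$-submodule of $\mathcal A$ for which $\mathcal A\cdot J\subseteq I$. (ii) If $N$ is a left ideal of $\mathcal A\rtimes\mathfrak A$ containing $\{0\}\times\mathfrak A$, then $I_N$ is a left ideal of $\mathcal A$ and $N=I_N\times\mathfrak A$. (iii) If $N$ is a left ideal of $\mathcal A\rtimes\mathfrak A$ containing $\mathcal A\times\{0\}$, then $J_N$ is a left ideal of $\mathfrak A$ and $N=\mathcal A\times J_N$. (iv) The subspace $I$ is a maximal left ideal and a left $\mathfrak A$-submodule of $\mathcal A$ for which $\mathcal A\cdot\mathfrak A\subseteq I$ if and only if $I\times\mathfrak A$ is a maximal left ideal of $\mathcal A\rtimes\mathfrak A$. (v) The subspace $J$ is a maximal left ideal of $\mathfrak A$ if and only if $\mathcal A\times J$ is a maximal left ideal of $\mathcal A\rtimes\mathfrak A$. (vi) The subspace $I\times J$ is a maximal left ideal of $\mathcal A\rtimes\mathfrak A$ if and only if either $I=\mathcal A$ and $J$ is a maximal left ideal of $\mathfrak A$, or $J=\mathfrak A$ and $I$ is both a maximal left ideal and a left $\mathfrak A$-submodule of $\mathcal A$ satisfying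 $\mathcal A\cdot\mathfrak A\subseteq I$.
   Context: The actions of $\mathfrak A$ on $\mathcal A$ are compatible if for all $a,b\in\mathcal A$ and $\beta\in\mathfrak A$: $\beta\cdot(ab)=(\beta\cdot a)b$, $(ab)\cdot\beta=a(b\cdot\beta)$, $a(\beta\cdot b)=(a\cdot\beta)b$. The amalgamated duplication $\mathcal A\rtimes\mathfrak A$ is $\mathcal A\times\mathfrak A$ with product $(a,\beta)(b,\gamma)=(ab+a\cdot\gamma+\beta\cdot b,\ \beta\gamma)$ and norm $\|(a,\beta)\|=\|a\|+\|\beta\|$. For subsets, $\mathcal A\cdot J=\{a\cdot\beta: a\in\mathcal A,\beta\in J\}$. For a left ideal $N$ of $\mathcal A\rtimes\mathfrak A$, $I_N=\{a\in\mathcal A: (a,\beta)\in N\text{ for some }\beta\in\mathfrak A\}$ and $J_N=\{\beta\in\mathfrak A:(a,\beta)\in N\text{ for some }a\in\mathcal A\}$.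
   Formalization: In (iv) and (vi), "maximal left ideal and left submodule" is taken to mean maximal among proper left ideals that are also left submodules; with maximality among all left ideals the claim fails (ℂ² with zero product, M₂(ℂ) acting on the left, zero right action, I = 0). *)

theory Defs
  imports "HOL-Analysis.Analysis"
begin

text \<open>
  The scalar field is any type of class \<^class>\<open>real_normed_field\<close>, which covers both
  the real and the complex numbers; its scalar multiplication extends \<^const>\<open>scaleR\<close>,
  and \<^locale>\<open>vector_space\<close> supplies the notion of linear subspace.
\<close>

locale banach_space_over = vector_space smul
  for smul :: "'k::real_normed_field \<Rightarrow> 'x::banach \<Rightarrow> 'x" +
  assumes smul_of_real: "smul (of_real t) x = t *\<^sub>R x"
    and norm_smul: "norm (smul c x) = norm c * norm x"

text \<open>Algebras need be neither unital nor commutative.\<close>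

locale banach_algebra_over = banach_space_over smul
  for smul :: "'k::real_normed_field \<Rightarrow> 'a::{real_normed_algebra, banach} \<Rightarrow> 'a" +
  assumes smul_mult_left: "smul c x * y = smul c (x * y)"
    and smul_mult_right: "x * smul c y = smul c (x * y)"

text \<open>
  The actions are jointly continuous, that is, bounded by \<open>C * norm \<beta> * norm x\<close> for some
  constant \<open>C\<close>; contractive actions are the case \<open>C = 1\<close>.
\<close>

locale banach_bimodule =
  B: banach_algebra_over scaleB + X: banach_space_over scaleX
  for scaleB :: "'k::real_normed_field \<Rightarrow> 'b::{real_normed_algebra, banach} \<Rightarrow> 'b"
    and scaleX :: "'k \<Rightarrow> 'x::banach \<Rightarrow> 'x" +
  fixes lact :: "'b \<Rightarrow> 'x \<Rightarrow> 'x" and ract :: "'x \<Rightarrow> 'b \<Rightarrow> 'x"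
  assumes bounded_bilinear_lact: "bounded_bilinear lact"
    and bounded_bilinear_ract: "bounded_bilinear ract"
    and lact_scaleB: "lact (scaleB c \<beta>) x = scaleX c (lact \<beta> x)"
    and lact_scaleX: "lact \<beta> (scaleX c x) = scaleX c (lact \<beta> x)"
    and ract_scaleB: "ract x (scaleB c \<beta>) = scaleX c (ract x \<beta>)"
    and ract_scaleX: "ract (scaleX c x) \<beta> = scaleX c (ract x \<beta>)"
    and lact_mult: "lact (\<beta> * \<gamma>) x = lact \<beta> (lact \<gamma> x)"
    and ract_mult: "ract x (\<beta> * \<gamma>) = ract (ract x \<beta>) \<gamma>"
    and lact_ract: "ract (lact \<beta> x) \<gamma> = lact \<beta> (ract x \<gamma>)"

definition compatible_actions ::
  "('b \<Rightarrow> 'a::semigroup_mult \<Rightarrow> 'a) \<Rightarrow> ('a \<Rightarrow> 'b \<Rightarrow> 'a) \<Rightarrow> bool" where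
  "compatible_actions lact ract \<longleftrightarrow>
     (\<forall>a b \<beta>. lact \<beta> (a * b) = lact \<beta> a * b \<and>
              ract (a * b) \<beta> = a * ract b \<beta> \<and>
              a * lact \<beta> b = ract a \<beta> * b)"

text \<open>
  The amalgamated duplication has the underlying type \<^typ>\<open>'a \<times> 'b\<close>, the componentwise
  scalar multiplication \<^const>\<open>module_prod.scale\<close> and the product below. Left ideals and
  their maximality are purely algebraic, so the norm \<open>norm a + norm \<beta>\<close> of \<open>(a, \<beta>)\<close> does
  not enter.
\<close>

fun amalg_mult ::
  "('b::times \<Rightarrow> 'a::{plus, times} \<Rightarrow> 'a) \<Rightarrow> ('a \<Rightarrow> 'b \<Rightarrow> 'a) \<Rightarrow> 'a \<times> 'b \<Rightarrow> 'a \<times> 'b \<Rightarrow> 'a \<times> 'b"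
where
  "amalg_mult lact ract (a, \<beta>) (b, \<gamma>) = (a * b + ract a \<gamma> + lact \<beta> b, \<beta> * \<gamma>)"

definition left_ideal ::
  "('k::comm_ring_1 \<Rightarrow> 'v::ab_group_add \<Rightarrow> 'v) \<Rightarrow> ('v \<Rightarrow> 'v \<Rightarrow> 'v) \<Rightarrow> 'v set \<Rightarrow> bool" where
  "left_ideal smul mul L \<longleftrightarrow>
     module.subspace smul L \<and> (\<forall>x. \<forall>y\<in>L. mul x y \<in> L)"

definition left_submodule ::
  "('k::comm_ring_1 \<Rightarrow> 'v::ab_group_add \<Rightarrow> 'v) \<Rightarrow> ('b \<Rightarrow> 'v \<Rightarrow> 'v) \<Rightarrow> 'v set \<Rightarrow> bool" where
  "left_submodule smul lact L \<longleftrightarrow>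
     module.subspace smul L \<and> (\<forall>\<beta>. \<forall>x\<in>L. lact \<beta> x \<in> L)"

definition maximal_proper :: "('v set \<Rightarrow> bool) \<Rightarrow> 'v set \<Rightarrow> bool" where
  "maximal_proper P L \<longleftrightarrow>
     P L \<and> L \<noteq> UNIV \<and> (\<forall>M. P M \<and> L \<subseteq> M \<longrightarrow> M = L \<or> M = UNIV)"

definition maximal_left_ideal ::
  "('k::comm_ring_1 \<Rightarrow> 'v::ab_group_add \<Rightarrow> 'v) \<Rightarrow> ('v \<Rightarrow> 'v \<Rightarrow> 'v) \<Rightarrow> 'v set \<Rightarrow> bool" where
  "maximal_left_ideal smul mul = maximal_proper (left_ideal smul mul)"

text \<open>
  ``A maximal left ideal and left submodule'' is read jointly: maximal among the proper
  left ideals that are also left submodules. With maximality among all proper left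
  ideals, the criterion for \<open>I \<times> UNIV\<close> fails: let the algebra of complex
  2-by-2 matrices act on column vectors from the left and by zero from the right,
  where column vectors carry the zero product, and let \<open>I = {0}\<close>.
\<close>

definition maximal_left_ideal_submodule ::
  "('k::comm_ring_1 \<Rightarrow> 'v::ab_group_add \<Rightarrow> 'v) \<Rightarrow> ('v \<Rightarrow> 'v \<Rightarrow> 'v) \<Rightarrow> ('b \<Rightarrow> 'v \<Rightarrow> 'v) \<Rightarrow>
     'v set \<Rightarrow> bool" where
  "maximal_left_ideal_submodule smul mul lact =
     maximal_proper (\<lambda>L. left_ideal smul mul L \<and> left_submodule smul lact L)"

lemma maximal_left_ideal_submoduleI:
  assumes "maximal_left_ideal smul mul L" and "left_submodule smul lact L"
  shows "maximal_left_ideal_submodule smul mul lact L"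
  using assms
  by (auto simp: maximal_left_ideal_def maximal_left_ideal_submodule_def maximal_proper_def)

definition act_set :: "('a \<Rightarrow> 'b \<Rightarrow> 'a) \<Rightarrow> 'a set \<Rightarrow> 'b set \<Rightarrow> 'a set" where
  "act_set ract S J = {ract a \<beta> | a \<beta>. a \<in> S \<and> \<beta> \<in> J}"

definition ideal_fst :: "('a \<times> 'b) set \<Rightarrow> 'a set" where
  "ideal_fst N = {a. \<exists>\<beta>. (a, \<beta>) \<in> N}"

definition ideal_snd :: "('a \<times> 'b) set \<Rightarrow> 'b set" where
  "ideal_snd N = {\<beta>. \<exists>a. (a, \<beta>) \<in> N}"

end

theory Submission
  imports Defs
begin

text \<open>
  Everything rests on the four kinds of products that the multiplication
  \<open>(a, \<beta>)(b, \<gamma>) = (ab + a\<cdot>\<gamma> + \<beta>\<cdot>b, \<beta>\<gamma>)\<close> mixes: \<open>ab\<close>, \<open>a\<cdot>\<gamma>\<close>, \<open>\<beta>\<cdot>b\<close> and \<open>\<beta>\<gamma>\<close>.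
  Setting one coordinate of each factor to zero isolates each of them, so \<open>I \<times> J\<close>
  absorbs left multiplication exactly if \<open>I\<close> absorbs \<open>ab\<close> and \<open>\<beta>\<cdot>b\<close>, all \<open>a\<cdot>\<gamma>\<close> with
  \<open>\<gamma> \<in> J\<close> lie in \<open>I\<close>, and \<open>J\<close> absorbs \<open>\<beta>\<gamma>\<close> (\<open>left_ideal_Times_iff\<close>).

  A subspace that contains one of the two factors is a rectangle
  (\<open>subspace_eq_fst_Times_UNIV\<close>, \<open>subspace_eq_UNIV_Times_snd\<close>), because the coordinate in
  that factor can be changed freely by adding elements of it. Hence the left ideals above
  \<open>I \<times> UNIV\<close> or \<open>UNIV \<times> J\<close> are again rectangles, the criterion for rectangles describes
  them, and maximality in the product becomes maximality in the other factor. The condition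
  that all \<open>a\<cdot>\<gamma>\<close> lie in \<open>I\<close> passes to larger subspaces, while the submodule condition does
  not; this is why the latter takes part in the maximality of \<open>I\<close>.

  Finally, if \<open>I \<times> J\<close> is a left ideal, so is \<open>UNIV \<times> J\<close>, which lies between \<open>I \<times> J\<close> and the
  whole algebra. If \<open>I \<times> J\<close> is maximal, then it equals \<open>UNIV \<times> J\<close> or \<open>UNIV \<times> J\<close> is
  everything: one of the two factors is full, and the previous cases apply.
\<close>

text \<open>
  The algebraic core of the setting: the actions absorb zero on both sides, so that a factor
  with a zero coordinate makes the corresponding terms of the product vanish.
\<close>

locale duplication_modules = module_prod scaleA scaleB
  for scaleA :: "'k::comm_ring_1 \<Rightarrow> 'a::ring \<Rightarrow> 'a"
    and scaleB :: "'k \<Rightarrow> 'b::ring \<Rightarrow> 'b" +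
  fixes lact :: "'b \<Rightarrow> 'a \<Rightarrow> 'a" and ract :: "'a \<Rightarrow> 'b \<Rightarrow> 'a"
  assumes lact_zero_left: "lact 0 a = 0" and lact_zero_right: "lact \<beta> 0 = 0"
    and ract_zero_left: "ract 0 \<beta> = 0" and ract_zero_right: "ract a 0 = 0"
begin

abbreviation ideal_A :: "'a set \<Rightarrow> bool" where
  "ideal_A \<equiv> left_ideal scaleA (*)"

abbreviation ideal_B :: "'b set \<Rightarrow> bool" where
  "ideal_B \<equiv> left_ideal scaleB (*)"

abbreviation submodule_A :: "'a set \<Rightarrow> bool" where
  "submodule_A \<equiv> left_submodule scaleA lact"

abbreviation ideal_AB :: "('a \<times> 'b) set \<Rightarrow> bool" where
  "ideal_AB \<equiv> left_ideal scale (amalg_mult lact ract)"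

lemma subspace_ideal_fst: "p.subspace N \<Longrightarrow> m1.subspace (ideal_fst N)"
  unfolding p.subspace_def m1.subspace_def ideal_fst_def
  by (fastforce simp: scale_def zero_prod_def)

lemma subspace_ideal_snd: "p.subspace N \<Longrightarrow> m2.subspace (ideal_snd N)"
  unfolding p.subspace_def m2.subspace_def ideal_snd_def
  by (fastforce simp: scale_def zero_prod_def)

lemma subspace_eq_fst_Times_UNIV:
  assumes N: "p.subspace N" and sub: "{0} \<times> UNIV \<subseteq> N"
  shows "N = ideal_fst N \<times> UNIV"
proof -
  have "(a, \<gamma>) \<in> N" if "(a, \<beta>) \<in> N" for a \<beta> \<gamma>
  proof -
    have "(a, \<beta>) + (0, \<gamma> - \<beta>) \<in> N"
      using p.subspace_add[OF N that] sub by blast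
    then show ?thesis by simp
  qed
  then show ?thesis by (auto simp: ideal_fst_def)
qed

lemma subspace_eq_UNIV_Times_snd:
  assumes N: "p.subspace N" and sub: "UNIV \<times> {0} \<subseteq> N"
  shows "N = UNIV \<times> ideal_snd N"
proof -
  have "(b, \<beta>) \<in> N" if "(a, \<beta>) \<in> N" for a b \<beta>
  proof -
    have "(a, \<beta>) + (b - a, 0) \<in> N"
      using p.subspace_add[OF N that] sub by blast
    then show ?thesis by simp
  qed
  then show ?thesis by (auto simp: ideal_snd_def)
qed

text \<open>
  The forward direction evaluates \<open>(a, \<beta>)(b, \<gamma>)\<close> at pairs with a zero coordinate, which
  belong to \<open>I \<times> J\<close> because subspaces contain zero.
\<close>

lemma left_ideal_Times_iff:
  assumes I: "m1.subspace I" and J: "m2.subspace J"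
  shows "ideal_AB (I \<times> J) \<longleftrightarrow>
    ideal_A I \<and> ideal_B J \<and> submodule_A I \<and> act_set ract UNIV J \<subseteq> I"
proof
  assume "ideal_AB (I \<times> J)"
  then have absorb: "a * b + ract a \<gamma> + lact \<beta> b \<in> I \<and> \<beta> * \<gamma> \<in> J"
    if "b \<in> I" "\<gamma> \<in> J" for a \<beta> b \<gamma>
    using that by (force simp: left_ideal_def)
  have zero: "0 \<in> I" "0 \<in> J"
    using I J by (simp_all add: m1.subspace_0 m2.subspace_0)
  have "a * b \<in> I" if "b \<in> I" for a b
    using absorb[OF that zero(2), of a 0] by (simp add: ract_zero_right lact_zero_left)
  moreover have "lact \<beta> b \<in> I" if "b \<in> I" for \<beta> b
    using absorb[OF that zero(2), of 0 \<beta>] by (simp add: ract_zero_right)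
  moreover have "ract a \<gamma> \<in> I" if "\<gamma> \<in> J" for a \<gamma>
    using absorb[OF zero(1) that, of a 0] by (simp add: lact_zero_right)
  moreover have "\<beta> * \<gamma> \<in> J" if "\<gamma> \<in> J" for \<beta> \<gamma>
    using absorb[OF zero(1) that] by blast
  ultimately show "ideal_A I \<and> ideal_B J \<and> submodule_A I \<and> act_set ract UNIV J \<subseteq> I"
    using I J by (auto simp: left_ideal_def left_submodule_def act_set_def)
next
  assume rhs: "ideal_A I \<and> ideal_B J \<and> submodule_A I \<and> act_set ract UNIV J \<subseteq> I"
  then have "ract a \<gamma> \<in> I" if "\<gamma> \<in> J" for a \<gamma>
    using that by (auto simp: act_set_def)
  with rhs show "ideal_AB (I \<times> J)"
    using subspace_Times[OF I J]
    by (auto simp: left_ideal_def left_submodule_def intro!: m1.subspace_add[OF I])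
qed

lemma left_ideal_Times_UNIV_iff:
  assumes "m1.subspace I"
  shows "ideal_AB (I \<times> UNIV) \<longleftrightarrow> ideal_A I \<and> submodule_A I \<and> act_set ract UNIV UNIV \<subseteq> I"
  using left_ideal_Times_iff[OF assms m2.subspace_UNIV] by (auto simp: left_ideal_def)

lemma left_ideal_UNIV_Times_iff:
  assumes "m2.subspace J"
  shows "ideal_AB (UNIV \<times> J) \<longleftrightarrow> ideal_B J"
  using left_ideal_Times_iff[OF m1.subspace_UNIV assms]
  by (auto simp: left_ideal_def left_submodule_def)

lemma left_ideal_containing_B:
  assumes "ideal_AB N" and "{0} \<times> UNIV \<subseteq> N"
  shows "ideal_A (ideal_fst N)" and "N = ideal_fst N \<times> UNIV"
proof -
  have N: "p.subspace N"
    using assms(1) by (simp add: left_ideal_def)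
  show eq: "N = ideal_fst N \<times> UNIV"
    by (rule subspace_eq_fst_Times_UNIV[OF N assms(2)])
  show "ideal_A (ideal_fst N)"
    using left_ideal_Times_UNIV_iff[OF subspace_ideal_fst[OF N]] assms(1) eq by simp
qed

lemma left_ideal_containing_A:
  assumes "ideal_AB N" and "UNIV \<times> {0} \<subseteq> N"
  shows "ideal_B (ideal_snd N)" and "N = UNIV \<times> ideal_snd N"
proof -
  have N: "p.subspace N"
    using assms(1) by (simp add: left_ideal_def)
  show eq: "N = UNIV \<times> ideal_snd N"
    by (rule subspace_eq_UNIV_Times_snd[OF N assms(2)])
  show "ideal_B (ideal_snd N)"
    using left_ideal_UNIV_Times_iff[OF subspace_ideal_snd[OF N]] assms(1) eq by simp
qed

text \<open>
  A left ideal above \<open>I \<times> UNIV\<close> has the form \<open>M \<times> UNIV\<close> with \<open>M\<close> both a left ideal and a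
  submodule above \<open>I\<close>. Conversely, every such \<open>M\<close> gives a left ideal, since \<open>M\<close> inherits
  from \<open>I\<close> the products \<open>a\<cdot>\<gamma>\<close>.
\<close>

lemma maximal_left_ideal_Times_UNIV_iff:
  assumes I: "m1.subspace I"
  shows "maximal_left_ideal scale (amalg_mult lact ract) (I \<times> UNIV) \<longleftrightarrow>
    maximal_left_ideal_submodule scaleA (*) lact I \<and> act_set ract UNIV UNIV \<subseteq> I"
proof
  assume max: "maximal_left_ideal scale (amalg_mult lact ract) (I \<times> UNIV)"
  then have "ideal_AB (I \<times> UNIV)"
    by (simp add: maximal_left_ideal_def maximal_proper_def)
  then have left: "ideal_A I" "submodule_A I" and act: "act_set ract UNIV UNIV \<subseteq> I"
    using left_ideal_Times_UNIV_iff[OF I] by blast+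
  have "M = I \<or> M = UNIV" if M: "ideal_A M" "submodule_A M" "I \<subseteq> M" for M
  proof -
    have "ideal_AB (M \<times> UNIV)"
      using left_ideal_Times_UNIV_iff[of M] M act by (auto simp: left_ideal_def)
    moreover have "I \<times> UNIV \<subseteq> M \<times> UNIV"
      using M(3) by blast
    ultimately have "M \<times> (UNIV :: 'b set) = I \<times> UNIV \<or> M \<times> (UNIV :: 'b set) = UNIV"
      using max unfolding maximal_left_ideal_def maximal_proper_def by blast
    then show ?thesis by auto
  qed
  moreover have "I \<noteq> UNIV"
    using max by (auto simp: maximal_left_ideal_def maximal_proper_def)
  ultimately show "maximal_left_ideal_submodule scaleA (*) lact I \<and> act_set ract UNIV UNIV \<subseteq> I"
    using left act by (simp add: maximal_left_ideal_submodule_def maximal_proper_def)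
next
  assume rhs: "maximal_left_ideal_submodule scaleA (*) lact I \<and> act_set ract UNIV UNIV \<subseteq> I"
  then have ideal: "ideal_AB (I \<times> UNIV)"
    using left_ideal_Times_UNIV_iff[OF I]
    by (simp add: maximal_left_ideal_submodule_def maximal_proper_def)
  have "N = I \<times> UNIV \<or> N = UNIV" if N: "ideal_AB N" "I \<times> UNIV \<subseteq> N" for N
  proof -
    have "{0} \<times> UNIV \<subseteq> N"
      using N(2) m1.subspace_0[OF I] by blast
    then have eq: "N = ideal_fst N \<times> UNIV"
      using left_ideal_containing_B(2) N(1) by blast
    have "p.subspace N"
      using N(1) by (simp add: left_ideal_def)
    then have "ideal_A (ideal_fst N)" "submodule_A (ideal_fst N)"
      using left_ideal_Times_UNIV_iff[of "ideal_fst N"] subspace_ideal_fst N(1) eq by simp_all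
    moreover have "I \<subseteq> ideal_fst N"
      using N(2) by (auto simp: ideal_fst_def)
    ultimately have "ideal_fst N = I \<or> ideal_fst N = UNIV"
      using rhs unfolding maximal_left_ideal_submodule_def maximal_proper_def by blast
    then show ?thesis
      using eq by auto
  qed
  moreover have "I \<times> (UNIV :: 'b set) \<noteq> UNIV"
    using rhs by (auto simp: maximal_left_ideal_submodule_def maximal_proper_def)
  ultimately show "maximal_left_ideal scale (amalg_mult lact ract) (I \<times> UNIV)"
    using ideal by (simp add: maximal_left_ideal_def maximal_proper_def)
qed

lemma maximal_left_ideal_UNIV_Times_iff:
  assumes J: "m2.subspace J"
  shows "maximal_left_ideal scale (amalg_mult lact ract) (UNIV \<times> J) \<longleftrightarrow>
    maximal_left_ideal scaleB (*) J"
proof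
  assume max: "maximal_left_ideal scale (amalg_mult lact ract) (UNIV \<times> J)"
  have "M = J \<or> M = UNIV" if M: "ideal_B M" "J \<subseteq> M" for M
  proof -
    have "ideal_AB (UNIV \<times> M)"
      using left_ideal_UNIV_Times_iff[of M] M by (auto simp: left_ideal_def)
    moreover have "UNIV \<times> J \<subseteq> UNIV \<times> M"
      using M(2) by blast
    ultimately have "(UNIV :: 'a set) \<times> M = UNIV \<times> J \<or> (UNIV :: 'a set) \<times> M = UNIV"
      using max unfolding maximal_left_ideal_def maximal_proper_def by blast
    then show ?thesis by auto
  qed
  moreover have "ideal_B J" "J \<noteq> UNIV"
    using max left_ideal_UNIV_Times_iff[OF J]
    by (auto simp: maximal_left_ideal_def maximal_proper_def)
  ultimately show "maximal_left_ideal scaleB (*) J"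
    by (simp add: maximal_left_ideal_def maximal_proper_def)
next
  assume max: "maximal_left_ideal scaleB (*) J"
  have "N = UNIV \<times> J \<or> N = UNIV" if N: "ideal_AB N" "UNIV \<times> J \<subseteq> N" for N
  proof -
    have "UNIV \<times> {0} \<subseteq> N"
      using N(2) m2.subspace_0[OF J] by blast
    then have eq: "N = UNIV \<times> ideal_snd N" and "ideal_B (ideal_snd N)"
      using left_ideal_containing_A N(1) by blast+
    moreover have "J \<subseteq> ideal_snd N"
      using N(2) by (auto simp: ideal_snd_def)
    ultimately have "ideal_snd N = J \<or> ideal_snd N = UNIV"
      using max unfolding maximal_left_ideal_def maximal_proper_def by blast
    then show ?thesis
      using eq by auto
  qed
  moreover have "ideal_AB (UNIV \<times> J)" "(UNIV :: 'a set) \<times> J \<noteq> UNIV"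
    using max left_ideal_UNIV_Times_iff[OF J]
    by (auto simp: maximal_left_ideal_def maximal_proper_def)
  ultimately show "maximal_left_ideal scale (amalg_mult lact ract) (UNIV \<times> J)"
    by (simp add: maximal_left_ideal_def maximal_proper_def)
qed

text \<open>
  The left ideal \<open>UNIV \<times> J\<close> lies above \<open>I \<times> J\<close>, and maximality leaves it only two values:
  \<open>I \<times> J\<close> itself or the whole algebra.
\<close>

lemma maximal_left_ideal_Times_full_factor:
  assumes I: "m1.subspace I" and J: "m2.subspace J"
    and max: "maximal_left_ideal scale (amalg_mult lact ract) (I \<times> J)"
  shows "I = UNIV \<or> J = UNIV"
proof -
  have "ideal_AB (I \<times> J)"
    using max by (simp add: maximal_left_ideal_def maximal_proper_def)
  then have "ideal_AB (UNIV \<times> J)"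
    using left_ideal_Times_iff[OF I J] left_ideal_UNIV_Times_iff[OF J] by blast
  moreover have "I \<times> J \<subseteq> UNIV \<times> J"
    by blast
  ultimately have "UNIV \<times> J = I \<times> J \<or> (UNIV :: 'a set) \<times> J = UNIV"
    using max unfolding maximal_left_ideal_def maximal_proper_def by blast
  \<comment> \<open>Since \<open>J\<close> contains zero, it is nonempty and can be cancelled from \<open>UNIV \<times> J = I \<times> J\<close>.\<close>
  then show ?thesis
    using m2.subspace_0[OF J] by auto
qed

end

lemma banach_bimodule_duplication_modules:
  fixes scaleA :: "'k::real_normed_field \<Rightarrow> 'a::{real_normed_algebra, banach} \<Rightarrow> 'a"
  assumes "banach_bimodule scaleB scaleA lact ract"
  shows "duplication_modules scaleA scaleB lact ract"
proof -
  interpret M: banach_bimodule scaleB scaleA lact ract by fact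
  interpret L: bounded_bilinear lact by (rule M.bounded_bilinear_lact)
  interpret R: bounded_bilinear ract by (rule M.bounded_bilinear_ract)
  show ?thesis
    by unfold_locales (simp_all add: L.zero_left L.zero_right R.zero_left R.zero_right)
qed

theorem proposition3p4:
  fixes scaleA :: "'k::real_normed_field \<Rightarrow> 'a::{real_normed_algebra, banach} \<Rightarrow> 'a"
    and scaleB :: "'k \<Rightarrow> 'b::{real_normed_algebra, banach} \<Rightarrow> 'b"
    and lact :: "'b \<Rightarrow> 'a \<Rightarrow> 'a" and ract :: "'a \<Rightarrow> 'b \<Rightarrow> 'a"
    and I :: "'a set" and J :: "'b set"
  assumes "banach_algebra_over scaleA" and "banach_algebra_over scaleB"
    and "banach_bimodule scaleB scaleA lact ract"
    and "compatible_actions lact ract"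
    and "I \<noteq> {}" and "module.subspace scaleA I"
    and "J \<noteq> {}" and "module.subspace scaleB J"
  shows
    "(left_ideal (module_prod.scale scaleA scaleB) (amalg_mult lact ract) (I \<times> J) \<longleftrightarrow>
        left_ideal scaleA (*) I \<and> left_ideal scaleB (*) J \<and>
        left_submodule scaleA lact I \<and> act_set ract UNIV J \<subseteq> I)
     \<and> (\<forall>N. left_ideal (module_prod.scale scaleA scaleB) (amalg_mult lact ract) N \<and>
            {0} \<times> UNIV \<subseteq> N \<longrightarrow>
          left_ideal scaleA (*) (ideal_fst N) \<and> N = ideal_fst N \<times> UNIV)
     \<and> (\<forall>N. left_ideal (module_prod.scale scaleA scaleB) (amalg_mult lact ract) N \<and>
            UNIV \<times> {0} \<subseteq> N \<longrightarrow>
          left_ideal scaleB (*) (ideal_snd N) \<and> N = UNIV \<times> ideal_snd N)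
     \<and> (maximal_left_ideal_submodule scaleA (*) lact I \<and> act_set ract UNIV UNIV \<subseteq> I \<longleftrightarrow>
          maximal_left_ideal (module_prod.scale scaleA scaleB) (amalg_mult lact ract)
            (I \<times> UNIV))
     \<and> (maximal_left_ideal scaleB (*) J \<longleftrightarrow>
          maximal_left_ideal (module_prod.scale scaleA scaleB) (amalg_mult lact ract)
            (UNIV \<times> J))
     \<and> (maximal_left_ideal (module_prod.scale scaleA scaleB) (amalg_mult lact ract)
            (I \<times> J) \<longleftrightarrow>
          I = UNIV \<and> maximal_left_ideal scaleB (*) J \<or>
          J = UNIV \<and> maximal_left_ideal_submodule scaleA (*) lact I \<and>
            act_set ract UNIV UNIV \<subseteq> I)"
proof -
  interpret duplication_modules scaleA scaleB lact ract
    using assms(3) by (rule banach_bimodule_duplication_modules)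
  note I = \<open>module.subspace scaleA I\<close> and J = \<open>module.subspace scaleB J\<close>
  have rectangle: "maximal_left_ideal scale (amalg_mult lact ract) (I \<times> J) \<longleftrightarrow>
      I = UNIV \<and> maximal_left_ideal scaleB (*) J \<or>
      J = UNIV \<and> maximal_left_ideal_submodule scaleA (*) lact I \<and> act_set ract UNIV UNIV \<subseteq> I"
    using maximal_left_ideal_Times_full_factor[OF I J]
      maximal_left_ideal_Times_UNIV_iff[OF I] maximal_left_ideal_UNIV_Times_iff[OF J]
    by blast
  show ?thesis
    by (intro conjI allI impI left_ideal_Times_iff I J left_ideal_containing_A
        left_ideal_containing_B maximal_left_ideal_Times_UNIV_iff[symmetric]
        maximal_left_ideal_UNIV_Times_iff[symmetric] rectangle; blast)
qed

end
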